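(* Let $\mathcal L:\mathbb{R}^{d_1}\times\mathbb{R}^{d_2}\to\mathbb{R}$ and suppose that the operator $$F(x)=\begin{bmatrix}\nabla_{w_1}\mathcal L(w_1,w_2)\\-\nabla_{w_2}\mathcal L(w_1,w_2)\end{bmatrix},\qquad x=(w_1^\top,w_2^\top)^\top,$$ associated with $\min_{w_1}\max_{w_2}\mathcal L(w_1,w_2)$ is differentiable, with Jacobian $$\mathbf J(x)=\begin{bmatrix}\nabla^2_{w_1w_1}\mathcal L(w_1,w_2)&\nabla^2_{w_2w_1}\mathcal L(w_1,w_2)\\-\nabla^2_{w_1w_2}\mathcal L(w_1,w_2)&-\nabla^2_{w_2w_2}\mathcal L(w_1,w_2)\end{bmatrix}.$$ Then $F$ is $\alpha$-symmetric $(L_0,L_1)$-Lipschitz if and only if $$\|\mathbf J(x)\|\le L_0+L_1\|F(x)\|^\alpha\qquad\text{for all }x,$$ where $\|\mathbf J(x)\|=\sigma_{\max}(\mathbf J(x))$ is the maximum singular value. In particular, $\|\mathbf J(x)\|\le L$ for all $x$ when $F$ is $L$-Lipschitz.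
   Context: For $L_0,L_1\ge0$ and $\alpha\in(0,1]$, an operator $F:\mathbb{R}^d\to\mathbb{R}^d$ is $\alpha$-symmetric $(L_0,L_1)$-Lipschitz if for all $x,y\in\mathbb{R}^d$ $$\|F(x)-F(y)\|\le\left(L_0+L_1\max_{\theta\in[0,1]}\|F(\theta x+(1-\theta)y)\|^\alpha\right)\|x-y\|.$$ *)

theory Defs
  imports "HOL-Analysis.Analysis"
begin

text \<open>The maximum over the segment is written as a supremum; for continuous \<open>F\<close>, in particular
  for differentiable \<open>F\<close>, it is attained and the two coincide.\<close>

definition alpha_symmetric_lipschitz ::
  "real \<Rightarrow> real \<Rightarrow> real \<Rightarrow> ('a::real_normed_vector \<Rightarrow> 'a) \<Rightarrow> bool" where
  "alpha_symmetric_lipschitz \<alpha> L0 L1 F \<longleftrightarrow>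
    (\<forall>x y. norm (F x - F y)
       \<le> (L0 + L1 * (SUP \<theta>\<in>{0..1::real}. norm (F (\<theta> *\<^sub>R x + (1 - \<theta>) *\<^sub>R y)) powr \<alpha>)) * norm (x - y))"

definition gradient :: "('a::real_inner \<Rightarrow> real) \<Rightarrow> 'a \<Rightarrow> 'a" where
  "gradient f w = (THE D. GDERIV f w :> D)"

definition singular_values :: "real^'n^'m \<Rightarrow> real set" where
  "singular_values A =
    {s. 0 \<le> s \<and> (\<exists>v. v \<noteq> 0 \<and> (transpose A ** A) *v v = s\<^sup>2 *\<^sub>R v)}"

definition sigma_max :: "real^'n^'m \<Rightarrow> real" where
  "sigma_max A = Max (singular_values A)"

text \<open>Stacked vectors are indexed by the disjoint sum of the two index types.\<close>

definition stack :: "real^'n \<Rightarrow> real^'m \<Rightarrow> real^('n + 'm)" where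
  "stack u v = (\<chi> i. case i of Inl a \<Rightarrow> u $ a | Inr b \<Rightarrow> v $ b)"

definition part1 :: "real^('n::finite + 'm::finite) \<Rightarrow> real^'n" where
  "part1 x = (\<chi> a. x $ Inl a)"

definition part2 :: "real^('n::finite + 'm::finite) \<Rightarrow> real^'m" where
  "part2 x = (\<chi> b. x $ Inr b)"

definition block_matrix ::
  "real^'n^'n \<Rightarrow> real^'m^'n \<Rightarrow> real^'n^'m \<Rightarrow> real^'m^'m \<Rightarrow> real^('n + 'm)^('n + 'm)" where
  "block_matrix A B C D =
    (\<chi> i j. case i of
       Inl a \<Rightarrow> (case j of Inl a' \<Rightarrow> A $ a $ a' | Inr b' \<Rightarrow> B $ a $ b')
     | Inr b \<Rightarrow> (case j of Inl a' \<Rightarrow> C $ b $ a' | Inr b' \<Rightarrow> D $ b $ b'))"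

context
  fixes \<L> :: "(real^'n) \<times> (real^'m) \<Rightarrow> real"
begin

definition grad1 :: "real^'n \<Rightarrow> real^'m \<Rightarrow> real^'n" where
  "grad1 w1 w2 = gradient (\<lambda>u. \<L> (u, w2)) w1"

definition grad2 :: "real^'n \<Rightarrow> real^'m \<Rightarrow> real^'m" where
  "grad2 w1 w2 = gradient (\<lambda>v. \<L> (w1, v)) w2"

definition saddle_operator :: "real^('n + 'm) \<Rightarrow> real^('n + 'm)" where
  "saddle_operator x =
    stack (grad1 (part1 x) (part2 x)) (- grad2 (part1 x) (part2 x))"

text \<open>\<open>hess_ij\<close> is \<open>\<nabla>\<^sup>2\<close> with subscripts \<open>w\<^sub>i w\<^sub>j\<close>: the Jacobian in \<open>w\<^sub>i\<close> of the gradient in \<open>w\<^sub>j\<close>,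
  with rows indexed by the components of \<open>w\<^sub>j\<close> and columns by those of \<open>w\<^sub>i\<close>.\<close>

definition hess_11 :: "real^'n \<Rightarrow> real^'m \<Rightarrow> real^'n^'n" where
  "hess_11 w1 w2 = jacobian (\<lambda>u. grad1 u w2) (at w1)"

definition hess_21 :: "real^'n \<Rightarrow> real^'m \<Rightarrow> real^'m^'n" where
  "hess_21 w1 w2 = jacobian (\<lambda>v. grad1 w1 v) (at w2)"

definition hess_12 :: "real^'n \<Rightarrow> real^'m \<Rightarrow> real^'n^'m" where
  "hess_12 w1 w2 = jacobian (\<lambda>u. grad2 u w2) (at w1)"

definition hess_22 :: "real^'n \<Rightarrow> real^'m \<Rightarrow> real^'m^'m" where
  "hess_22 w1 w2 = jacobian (\<lambda>v. grad2 w1 v) (at w2)"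

definition saddle_jacobian :: "real^('n + 'm) \<Rightarrow> real^('n + 'm)^('n + 'm)" where
  "saddle_jacobian x =
    (let w1 = part1 x; w2 = part2 x in
     block_matrix (hess_11 w1 w2) (hess_21 w1 w2) (- hess_12 w1 w2) (- hess_22 w1 w2))"

end

lemma gradient_eqI: "GDERIV f w :> D \<Longrightarrow> gradient f w = D"
  unfolding gradient_def gderiv_def
proof (rule the_equality)
  fix D' assume "(f has_derivative (\<lambda>h. h \<bullet> D)) (at w)" "(f has_derivative (\<lambda>h. h \<bullet> D')) (at w)"
  then have "(\<lambda>h. h \<bullet> D) = (\<lambda>h. h \<bullet> D')"
    by (rule has_derivative_unique)
  then show "D' = D"
    by (metis vector_eq_ldot)
qed

lemma jacobian_eqI:
  fixes f :: "real^'a \<Rightarrow> real^'b"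
  assumes "(f has_derivative f') (at x)"
  shows "jacobian f (at x) = matrix f'"
  using frechet_derivative_at[OF assms] by (simp add: jacobian_def)

lemma bounded_linear_part1: "bounded_linear part1"
  unfolding linear_conv_bounded_linear[symmetric]
  by (rule linearI) (auto simp: part1_def vec_eq_iff)

lemma bounded_linear_part2: "bounded_linear part2"
  unfolding linear_conv_bounded_linear[symmetric]
  by (rule linearI) (auto simp: part2_def vec_eq_iff)

lemma bounded_linear_stack1: "bounded_linear (\<lambda>u. stack u 0)"
  unfolding linear_conv_bounded_linear[symmetric]
  by (rule linearI) (auto simp: stack_def vec_eq_iff split: sum.splits)

lemma bounded_linear_stack2: "bounded_linear (\<lambda>v. stack 0 v)"
  unfolding linear_conv_bounded_linear[symmetric]
  by (rule linearI) (auto simp: stack_def vec_eq_iff split: sum.splits)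

lemma part_stack [simp]: "part1 (stack u v) = u" "part2 (stack u v) = v" "stack (part1 x) (part2 x) = x"
  by (auto simp: part1_def part2_def stack_def vec_eq_iff split: sum.splits)

lemma stack_split: "stack u v = stack u 0 + stack 0 v"
  by (auto simp: stack_def vec_eq_iff split: sum.splits)

lemma jacobian_saddle_operator:
  fixes \<L> :: "(real^'n) \<times> (real^'m) \<Rightarrow> real"
  assumes "saddle_operator \<L> differentiable at x"
  shows "jacobian (saddle_operator \<L>) (at x) = saddle_jacobian \<L> x"
proof -
  define D where "D = frechet_derivative (saddle_operator \<L>) (at x)"
  let ?w1 = "part1 x" and ?w2 = "part2 x"
  have D: "(saddle_operator \<L> has_derivative D) (at x)"
    using assms by (simp add: D_def frechet_derivative_works)
  have e1: "(\<lambda>u. stack u ?w2) = (\<lambda>u. stack u 0 + stack 0 ?w2)"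
    by (intro ext stack_split)
  have e2: "(\<lambda>v. stack ?w1 v) = (\<lambda>v. stack ?w1 0 + stack 0 v)"
    by (intro ext stack_split)
  have s1: "((\<lambda>u. stack u ?w2) has_derivative (\<lambda>h. stack h 0)) (at ?w1)"
    unfolding e1
    using has_derivative_add[OF bounded_linear_imp_has_derivative[OF bounded_linear_stack1]
        has_derivative_const[of "stack 0 ?w2"]] by simp
  have "((\<lambda>v. stack ?w1 0 + stack 0 v) has_derivative (\<lambda>h. stack 0 h)) (at ?w2)"
    using has_derivative_add[OF has_derivative_const[of "stack ?w1 0"]
        bounded_linear_imp_has_derivative[OF bounded_linear_stack2]] by simp
  then have s2: "((\<lambda>v. stack ?w1 v) has_derivative (\<lambda>h. stack 0 h)) (at ?w2)"
    by (subst e2)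
  have F1: "((\<lambda>u. saddle_operator \<L> (stack u ?w2)) has_derivative (\<lambda>h. D (stack h 0))) (at ?w1)"
    by (rule has_derivative_compose[OF s1]) (simp add: D)
  have F2: "((\<lambda>v. saddle_operator \<L> (stack ?w1 v)) has_derivative (\<lambda>h. D (stack 0 h))) (at ?w2)"
    by (rule has_derivative_compose[OF s2]) (simp add: D)
  note p1 = bounded_linear.has_derivative[OF bounded_linear_part1]
  note p2 = bounded_linear.has_derivative[OF bounded_linear_part2]
  have h11: "hess_11 \<L> ?w1 ?w2 = matrix (\<lambda>h. part1 (D (stack h 0)))"
    using p1[OF F1] unfolding hess_11_def by (intro jacobian_eqI) (simp add: saddle_operator_def)
  have h21: "hess_21 \<L> ?w1 ?w2 = matrix (\<lambda>h. part1 (D (stack 0 h)))"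
    using p1[OF F2] unfolding hess_21_def by (intro jacobian_eqI) (simp add: saddle_operator_def)
  have h12: "hess_12 \<L> ?w1 ?w2 = matrix (\<lambda>h. - part2 (D (stack h 0)))"
    using has_derivative_minus[OF p2[OF F1]] unfolding hess_12_def
    by (intro jacobian_eqI) (simp add: saddle_operator_def)
  have h22: "hess_22 \<L> ?w1 ?w2 = matrix (\<lambda>h. - part2 (D (stack 0 h)))"
    using has_derivative_minus[OF p2[OF F2]] unfolding hess_22_def
    by (intro jacobian_eqI) (simp add: saddle_operator_def)
  have ax: "stack (axis a 1) 0 = (axis (Inl a) 1 :: real^('n + 'm))"
      "stack 0 (axis b 1) = (axis (Inr b) 1 :: real^('n + 'm))" for a :: 'n and b :: 'm
    by (auto simp: stack_def vec_eq_iff axis_def split: sum.splits)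
  show ?thesis
    unfolding saddle_jacobian_def Let_def h11 h21 h12 h22 jacobian_eqI[OF D]
    by (auto simp: block_matrix_def matrix_def vec_eq_iff ax part1_def part2_def split: sum.splits)
qed

end

theory Submission
  imports Defs
begin

text \<open>
  The block matrix \<open>saddle_jacobian\<close> represents the derivative of the saddle operator
  (\<open>jacobian_saddle_operator\<close>), and the maximum singular value of a matrix is its operator norm.
  So the theorem compares a Lipschitz-type inequality for \<open>F\<close> with a bound on the operator norm
  of its derivative \<open>F' x\<close>.  This comparison is a fact about differentiable operators on any
  nonzero real normed space.

  If \<open>\<parallel>F' z\<parallel> \<le> L\<^sub>0 + L\<^sub>1 \<parallel>F z\<parallel>\<^sup>\<alpha>\<close> for all \<open>z\<close>, then the supremum over the segment between \<open>x\<close> and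
  \<open>y\<close> turns this into one bound for all derivatives along that segment, and the mean value
  inequality applies.  Conversely, the supremum over a segment from \<open>x\<close> that shrinks to \<open>x\<close>
  tends to \<open>\<parallel>F x\<parallel>\<^sup>\<alpha>\<close>, because \<open>F\<close> is continuous; so near \<open>x\<close> the increments from \<open>x\<close> grow
  at a rate at most \<open>L\<^sub>0 + L\<^sub>1 \<parallel>F x\<parallel>\<^sup>\<alpha> + \<epsilon>\<close>, and such a rate bounds the derivative at \<open>x\<close>.
  This last fact, \<open>onorm_derivative_le_local_rate\<close>, also gives the claim about
  \<open>L\<close>-Lipschitz operators.

  That \<open>sigma_max\<close> is the operator norm (\<open>sigma_max_eq_onorm\<close>) has three ingredients: no
  singular value exceeds the operator norm; a unit vector at which the operator norm is
  attained is an eigenvector of \<open>A\<^sup>T A\<close>, so the operator norm is a singular value; and there are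
  only finitely many singular values, so that the maximum in the definition is meaningful.
\<close>

section \<open>The maximum singular value is the operator norm\<close>

lemma gram_inner:
  fixes A :: "real^'n^'m"
  shows "((transpose A ** A) *v v) \<bullet> w = (A *v v) \<bullet> (A *v w)"
  by (simp add: matrix_vector_mul_assoc[symmetric] dot_lmul_matrix)

lemma norm_mult_singular_vector:
  fixes A :: "real^'n^'m"
  assumes "(transpose A ** A) *v v = s\<^sup>2 *\<^sub>R v" and "0 \<le> s"
  shows "norm (A *v v) = s * norm v"
proof -
  have "(norm (A *v v))\<^sup>2 = (s * norm v)\<^sup>2"
    using gram_inner[of A v v] assms(1) by (simp add: power2_norm_eq_inner power_mult_distrib)
  then show ?thesis
    using assms(2) by simp
qed

lemma singular_value_le_onorm:
  fixes A :: "real^'n^'m"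
  assumes "s \<in> singular_values A"
  shows "s \<le> onorm ((*v) A)"
proof -
  obtain v where v: "v \<noteq> 0" "(transpose A ** A) *v v = s\<^sup>2 *\<^sub>R v" and "0 \<le> s"
    using assms by (auto simp: singular_values_def)
  then have "s * norm v \<le> onorm ((*v) A) * norm v"
    using norm_mult_singular_vector[of A v s] onorm[of "(*v) A" v] by simp
  then show ?thesis
    using v(1) by simp
qed

text \<open>Eigenvectors of the symmetric matrix \<open>A\<^sup>T A\<close> for different eigenvalues are orthogonal,
  hence linearly independent, and the space has finite dimension.  Different singular values give
  different eigenvalues because they are nonnegative.\<close>

lemma finite_singular_values:
  fixes A :: "real^'n^'m"
  shows "finite (singular_values A)"
proof -
  let ?S = "singular_values A"
  have "\<forall>s\<in>?S. \<exists>v. v \<noteq> 0 \<and> (transpose A ** A) *v v = s\<^sup>2 *\<^sub>R v \<and> 0 \<le> s"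
    by (auto simp: singular_values_def)
  then obtain v where v: "v s \<noteq> 0" "(transpose A ** A) *v v s = s\<^sup>2 *\<^sub>R v s" "0 \<le> s"
    if "s \<in> ?S" for s
    unfolding bchoice_iff by blast
  have ortho: "v s \<bullet> v t = 0" if "s \<in> ?S" "t \<in> ?S" "s \<noteq> t" for s t
  proof -
    have "s\<^sup>2 * (v s \<bullet> v t) = t\<^sup>2 * (v s \<bullet> v t)"
      using gram_inner[of A "v s" "v t"] gram_inner[of A "v t" "v s"] v(2)[OF that(1)] v(2)[OF that(2)]
      by (simp add: inner_commute)
    moreover have "s\<^sup>2 \<noteq> t\<^sup>2"
      using that v(3) by simp
    ultimately show ?thesis
      by simp
  qed
  have "inj_on v ?S"
    using ortho v(1) by (metis inj_onI inner_eq_zero_iff)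
  moreover have "independent (v ` ?S)"
  proof (rule pairwise_orthogonal_independent)
    show "pairwise orthogonal (v ` ?S)"
      using ortho by (auto simp: pairwise_def orthogonal_def)
    show "0 \<notin> v ` ?S"
      using v(1) by auto
  qed
  ultimately show ?thesis
    by (meson finite_imageD independent_imp_finite)
qed

lemma onorm_attained:
  fixes f :: "'a::euclidean_space \<Rightarrow> 'b::real_normed_vector"
  assumes "bounded_linear f"
  obtains v where "norm v = 1" "norm (f v) = onorm f"
proof -
  interpret bounded_linear f
    by (rule assms)
  have "continuous_on (sphere 0 1) (\<lambda>v. norm (f v))"
    using assms by (intro continuous_intros linear_continuous_on)
  moreover have "sphere 0 1 \<noteq> ({} :: 'a set)"
    by simp
  ultimately obtain v where "v \<in> sphere 0 1"
    and max: "\<forall>w\<in>sphere 0 1. norm (f w) \<le> norm (f v)"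
    using continuous_attains_sup[OF compact_sphere] by blast
  then have v: "norm v = 1"
    by simp
  have "norm (f w) \<le> norm (f v) * norm w" for w
  proof (cases "w = 0")
    case True
    then show ?thesis
      by simp
  next
    case False
    have "norm (f ((1 / norm w) *\<^sub>R w)) \<le> norm (f v)"
      using False by (intro max[rule_format]) simp
    then show ?thesis
      using False by (simp add: scaleR field_simps)
  qed
  then have "onorm f \<le> norm (f v)"
    by (intro onorm_le)
  moreover have "norm (f v) \<le> onorm f"
    using onorm[OF assms, of v] v by simp
  ultimately show ?thesis
    using that v by simp
qed

lemma norm_transpose_mult_le:
  fixes A :: "real^'n^'m"
  shows "norm (transpose A *v w) \<le> onorm ((*v) A) * norm w"
proof (cases "transpose A *v w = 0")
  case True
  then show ?thesis
    by (simp add: onorm_pos_le)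
next
  case False
  let ?u = "transpose A *v w"
  have "norm ?u * norm ?u = w \<bullet> (A *v ?u)"
    using power2_norm_eq_inner[of ?u] by (simp add: dot_lmul_matrix power2_eq_square)
  also have "\<dots> \<le> norm w * norm (A *v ?u)"
    by (rule norm_cauchy_schwarz)
  also have "\<dots> \<le> norm w * (onorm ((*v) A) * norm ?u)"
    by (intro mult_left_mono onorm) auto
  finally have "norm ?u * norm ?u \<le> (onorm ((*v) A) * norm w) * norm ?u"
    by (simp add: mult_ac)
  then show ?thesis
    using False by simp
qed

text \<open>Let \<open>\<sigma>\<close> be the operator norm and \<open>v\<close> a unit vector with \<open>\<parallel>A v\<parallel> = \<sigma>\<close>.  Since
  \<open>\<parallel>A\<^sup>T A v\<parallel> \<le> \<sigma>\<^sup>2\<close>, expanding the square gives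
  \<open>\<parallel>A\<^sup>T A v - \<sigma>\<^sup>2 v\<parallel>\<^sup>2 = \<parallel>A\<^sup>T A v\<parallel>\<^sup>2 - 2 \<sigma>\<^sup>2 \<parallel>A v\<parallel>\<^sup>2 + \<sigma>\<^sup>4 \<le> 0\<close>.\<close>

lemma onorm_is_singular_value:
  fixes A :: "real^'n^'m"
  shows "onorm ((*v) A) \<in> singular_values A"
proof -
  define \<sigma> where "\<sigma> = onorm ((*v) A)"
  have "0 \<le> \<sigma>"
    by (simp add: \<sigma>_def onorm_pos_le)
  obtain v where v: "norm v = 1" "norm (A *v v) = \<sigma>"
    using onorm_attained[of "(*v) A"] by (auto simp: \<sigma>_def)
  define u where "u = (transpose A ** A) *v v"
  have "norm u \<le> \<sigma>\<^sup>2"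
    using norm_transpose_mult_le[of A "A *v v"] v(2)
    by (simp add: u_def \<sigma>_def matrix_vector_mul_assoc power2_eq_square del: transpose_matrix_vector)
  then have u: "(norm u)\<^sup>2 \<le> (\<sigma>\<^sup>2)\<^sup>2"
    by (rule power_mono) simp
  have uv: "u \<bullet> v = \<sigma>\<^sup>2"
    using gram_inner[of A v v] v(2) by (simp add: u_def power2_norm_eq_inner[symmetric])
  have "(norm (u - \<sigma>\<^sup>2 *\<^sub>R v))\<^sup>2 = (norm u)\<^sup>2 - 2 * \<sigma>\<^sup>2 * (u \<bullet> v) + \<sigma>\<^sup>2 * \<sigma>\<^sup>2 * (norm v)\<^sup>2"
    unfolding power2_norm_eq_inner by (simp add: inner_diff inner_commute algebra_simps)
  also have "\<dots> \<le> 0"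
    using u by (simp add: uv v(1) power2_eq_square)
  finally have "u = \<sigma>\<^sup>2 *\<^sub>R v"
    by simp
  moreover have "v \<noteq> 0"
    using v(1) by auto
  ultimately show ?thesis
    using \<open>0 \<le> \<sigma>\<close> by (auto simp: singular_values_def u_def \<sigma>_def)
qed

lemma sigma_max_eq_onorm:
  fixes A :: "real^'n^'m"
  shows "sigma_max A = onorm ((*v) A)"
  unfolding sigma_max_def
  by (intro Max_eqI finite_singular_values singular_value_le_onorm onorm_is_singular_value)

section \<open>Lipschitz conditions and the norm of the derivative\<close>

text \<open>Only the increments from the point \<open>x\<close> itself are controlled.  Scaling \<open>h\<close> down until
  \<open>x + t h\<close> lies near \<open>x\<close> and dividing by \<open>t\<close> shows \<open>\<parallel>f' h\<parallel> \<le> (B + e) \<parallel>h\<parallel>\<close> for every \<open>e > 0\<close>.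
  The class \<open>perfect_space\<close> excludes the zero space, where the increments vanish and \<open>B\<close> could be
  negative.\<close>

lemma onorm_derivative_le_local_rate:
  fixes f :: "'a::{real_normed_vector, perfect_space} \<Rightarrow> 'b::real_normed_vector"
  assumes f': "(f has_derivative f') (at x)"
    and rate: "\<forall>\<^sub>F y in nhds x. norm (f y - f x) \<le> B * norm (y - x)"
  shows "onorm f' \<le> B"
proof (rule onorm_le)
  fix h
  interpret f': bounded_linear f'
    using f' by (rule has_derivative_bounded_linear)
  show "norm (f' h) \<le> B * norm h"
  proof (cases "h = 0")
    case True
    then show ?thesis
      by simp
  next
    case False
    have bound: "norm (f' h) / norm h \<le> B + e" if "e > 0" for e
    proof -
      obtain d1 where d1: "d1 > 0"
        "\<And>y. norm (y - x) < d1 \<Longrightarrow> norm (f y - f x - f' (y - x)) \<le> e * norm (y - x)"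
        using f' \<open>e > 0\<close> unfolding has_derivative_at_alt by blast
      obtain d2 where d2: "d2 > 0" "\<And>y. norm (y - x) < d2 \<Longrightarrow> norm (f y - f x) \<le> B * norm (y - x)"
        using rate unfolding eventually_nhds_metric dist_norm by blast
      define t where "t = min d1 d2 / (2 * norm h)"
      define y where "y = x + t *\<^sub>R h"
      have "t > 0"
        using d1(1) d2(1) False by (simp add: t_def)
      have y: "norm (y - x) = t * norm h"
        using \<open>t > 0\<close> by (simp add: y_def)
      also have "\<dots> = min d1 d2 / 2"
        using False by (simp add: t_def)
      finally have "norm (y - x) < d1" "norm (y - x) < d2"
        using d1(1) d2(1) by auto
      then have "norm (f' (y - x)) \<le> B * norm (y - x) + e * norm (y - x)"
        using d1(2)[of y] d2(2)[of y] norm_triangle_ineq4[of "f y - f x" "f y - f x - f' (y - x)"]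
        by simp
      moreover have "norm (f' (y - x)) = t * norm (f' h)"
        using \<open>t > 0\<close> by (simp add: y_def f'.scaleR)
      ultimately have "t * norm (f' h) \<le> t * ((B + e) * norm h)"
        unfolding y by (simp add: algebra_simps)
      then show ?thesis
        using \<open>t > 0\<close> False by (simp add: divide_le_eq)
    qed
    then have "norm (f' h) / norm h \<le> B"
      by (rule field_le_epsilon)
    then show ?thesis
      using False by (simp add: divide_le_eq)
  qed
qed

lemma onorm_derivative_le_lipschitz:
  fixes f :: "'a::{real_normed_vector, perfect_space} \<Rightarrow> 'b::real_normed_vector"
  assumes "L-lipschitz_on UNIV f" and "(f has_derivative f') (at x)"
  shows "onorm f' \<le> L"
  using assms(2)
proof (rule onorm_derivative_le_local_rate)
  show "\<forall>\<^sub>F y in nhds x. norm (f y - f x) \<le> L * norm (y - x)"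
    using lipschitz_onD[OF assms(1)] by (simp add: dist_norm)
qed

text \<open>The values of \<open>F\<close> on a segment are bounded because the segment is compact, so the
  supremum over it dominates the bounds on all the derivatives needed by the mean value inequality.\<close>

lemma alpha_symmetric_lipschitz_if_derivative_bound:
  fixes F :: "'a::{real_normed_vector, perfect_space} \<Rightarrow> 'a"
  assumes L1: "0 \<le> L1" and \<alpha>: "0 < \<alpha>"
    and F': "\<And>x. (F has_derivative F' x) (at x)"
    and bound: "\<And>x. onorm (F' x) \<le> L0 + L1 * norm (F x) powr \<alpha>"
  shows "alpha_symmetric_lipschitz \<alpha> L0 L1 F"
  unfolding alpha_symmetric_lipschitz_def
proof (intro allI)
  fix x y :: 'a
  define p where "p \<theta> = \<theta> *\<^sub>R x + (1 - \<theta>) *\<^sub>R y" for \<theta> :: real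
  define g where "g \<theta> = norm (F (p \<theta>)) powr \<alpha>" for \<theta>
  have "continuous_on UNIV F"
    using F' has_derivative_continuous continuous_at_imp_continuous_on by blast
  then have "continuous_on {0..1} (\<lambda>\<theta>. F (p \<theta>))"
    unfolding p_def by (rule continuous_on_compose2) (auto intro!: continuous_intros)
  then have "continuous_on {0..1} g"
    unfolding g_def using \<alpha> by (intro continuous_on_powr' continuous_intros) auto
  then have bdd: "bdd_above (g ` {0..1})"
    by (intro bounded_imp_bdd_above compact_imp_bounded compact_continuous_image compact_Icc)
  have segment: "closed_segment y x = p ` {0..1}"
    unfolding closed_segment_def p_def by (auto simp: add.commute)
  show "norm (F x - F y)
      \<le> (L0 + L1 * (SUP \<theta>\<in>{0..1}. norm (F (\<theta> *\<^sub>R x + (1 - \<theta>) *\<^sub>R y)) powr \<alpha>)) * norm (x - y)"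
    unfolding p_def[symmetric] g_def[symmetric]
  proof (rule differentiable_bound)
    show "convex (closed_segment y x)" "x \<in> closed_segment y x" "y \<in> closed_segment y x"
      by auto
    show "(F has_derivative F' z) (at z within closed_segment y x)" for z
      using F' by (rule has_derivative_at_withinI)
    show "onorm (F' z) \<le> L0 + L1 * (SUP \<theta>\<in>{0..1}. g \<theta>)" if z: "z \<in> closed_segment y x" for z
    proof -
      obtain \<theta> where \<theta>: "\<theta> \<in> {0..1}" "z = p \<theta>"
        using z unfolding segment by blast
      then have "norm (F z) powr \<alpha> \<le> (SUP \<theta>\<in>{0..1}. g \<theta>)"
        using cSUP_upper[OF \<theta>(1) bdd] by (simp add: g_def)
      then show ?thesis
        using bound[of z] mult_left_mono[OF _ L1] by fastforce
    qed
  qed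
qed

text \<open>On a small ball around \<open>x\<close>, \<open>\<parallel>F z\<parallel>\<^sup>\<alpha>\<close> exceeds \<open>\<parallel>F x\<parallel>\<^sup>\<alpha>\<close> by at most \<open>\<epsilon>\<close>; the ball is convex,
  so the same is true of the supremum over any segment that joins \<open>x\<close> to a point of the ball.\<close>

lemma derivative_bound_if_alpha_symmetric_lipschitz:
  fixes F :: "'a::{real_normed_vector, perfect_space} \<Rightarrow> 'a"
  assumes L1: "0 \<le> L1" and \<alpha>: "0 < \<alpha>"
    and F': "(F has_derivative F') (at x)"
    and lip: "alpha_symmetric_lipschitz \<alpha> L0 L1 F"
  shows "onorm F' \<le> L0 + L1 * norm (F x) powr \<alpha>"
proof (rule field_le_epsilon)
  fix e :: real
  assume "e > 0"
  \<comment> \<open>The denominator \<open>L1 + 1\<close> gives \<open>L1 * \<epsilon> \<le> e\<close> and is positive also when \<open>L1 = 0\<close>.\<close>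
  define \<epsilon> where "\<epsilon> = e / (L1 + 1)"
  have \<epsilon>: "\<epsilon> > 0" "L1 * \<epsilon> \<le> e"
    using L1 \<open>e > 0\<close> by (auto simp: \<epsilon>_def field_simps)
  have "isCont F x"
    using F' by (rule has_derivative_continuous)
  then have "(F \<longlongrightarrow> F x) (nhds x)"
    by (simp add: continuous_at tendsto_nhds_iff)
  then have "((\<lambda>z. norm (F z) powr \<alpha>) \<longlongrightarrow> norm (F x) powr \<alpha>) (nhds x)"
    using \<alpha> by (intro tendsto_powr' tendsto_intros) auto
  then have "\<forall>\<^sub>F z in nhds x. norm (F z) powr \<alpha> < norm (F x) powr \<alpha> + \<epsilon>"
    using \<epsilon>(1) by (intro order_tendstoD) auto
  then obtain d where d: "d > 0" "\<And>z. dist z x < d \<Longrightarrow> norm (F z) powr \<alpha> < norm (F x) powr \<alpha> + \<epsilon>"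
    unfolding eventually_nhds_metric by blast
  have "norm (F y - F x) \<le> (L0 + L1 * norm (F x) powr \<alpha> + e) * norm (y - x)" if "dist y x < d" for y
  proof -
    let ?M = "SUP \<theta>\<in>{0..1::real}. norm (F (\<theta> *\<^sub>R y + (1 - \<theta>) *\<^sub>R x)) powr \<alpha>"
    have "?M \<le> norm (F x) powr \<alpha> + \<epsilon>"
    proof (rule cSUP_least)
      fix \<theta> :: real
      assume "\<theta> \<in> {0..1}"
      then have "\<theta> *\<^sub>R y + (1 - \<theta>) *\<^sub>R x \<in> ball x d"
        using that d(1) by (intro convexD[OF convex_ball]) (auto simp: dist_commute)
      then show "norm (F (\<theta> *\<^sub>R y + (1 - \<theta>) *\<^sub>R x)) powr \<alpha> \<le> norm (F x) powr \<alpha> + \<epsilon>"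
        using d(2) by (force simp: dist_commute)
    qed simp
    then have "L1 * ?M \<le> L1 * norm (F x) powr \<alpha> + e"
      using mult_left_mono[OF _ L1] \<epsilon>(2) by (fastforce simp: distrib_left)
    then have "(L0 + L1 * ?M) * norm (y - x) \<le> (L0 + L1 * norm (F x) powr \<alpha> + e) * norm (y - x)"
      by (intro mult_right_mono) auto
    then show ?thesis
      using lip unfolding alpha_symmetric_lipschitz_def by (meson order_trans)
  qed
  then have "\<forall>\<^sub>F y in nhds x. norm (F y - F x) \<le> (L0 + L1 * norm (F x) powr \<alpha> + e) * norm (y - x)"
    unfolding eventually_nhds_metric using d(1) by blast
  then show "onorm F' \<le> L0 + L1 * norm (F x) powr \<alpha> + e"
    by (rule onorm_derivative_le_local_rate[OF F'])
qed

section \<open>The saddle operator\<close>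

theorem theorem4p1:
  fixes \<L> :: "(real^'n) \<times> (real^'m) \<Rightarrow> real" and L0 L1 \<alpha> :: real
  assumes "0 \<le> L0" and "0 \<le> L1" and "0 < \<alpha>" and "\<alpha> \<le> 1"
    and "\<And>w1 w2. (\<lambda>u. \<L> (u, w2)) differentiable at w1"
    and "\<And>w1 w2. (\<lambda>v. \<L> (w1, v)) differentiable at w2"
    and "\<And>x. saddle_operator \<L> differentiable at x"
  shows "(alpha_symmetric_lipschitz \<alpha> L0 L1 (saddle_operator \<L>) \<longleftrightarrow>
            (\<forall>x. sigma_max (saddle_jacobian \<L> x) \<le> L0 + L1 * norm (saddle_operator \<L> x) powr \<alpha>))
       \<and> (\<forall>L. L-lipschitz_on UNIV (saddle_operator \<L>) \<longrightarrow>
            (\<forall>x. sigma_max (saddle_jacobian \<L> x) \<le> L))"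
proof -
  have F': "(saddle_operator \<L> has_derivative (*v) (saddle_jacobian \<L> x)) (at x)" for x
    using assms(7)[of x] jacobian_saddle_operator[OF assms(7)] jacobian_works by metis
  show ?thesis
    unfolding sigma_max_eq_onorm
    using derivative_bound_if_alpha_symmetric_lipschitz[OF assms(2,3) F']
      alpha_symmetric_lipschitz_if_derivative_bound[OF assms(2,3) F']
      onorm_derivative_le_lipschitz[OF _ F']
    by blast
qed

end
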